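(* Suppose $H_1,\ldots,H_t$ are simple $D$-regular graphs, each with chromatic index $D+1$, where $t>\tfrac12 D(D+1)$. Let $G$ be the complement of the graph formed by taking the disjoint union of $H_1,\ldots,H_t$, and let $n$ denote the number of vertices of $G$. Then the minimum degree of $G$ is $n-1-D$, but $G$ does not contain an immersion of the complete graph on $n-D$ vertices.
   Context: All graphs are finite. The chromatic index of a graph is the minimum number of colours in a proper edge-colouring, that is, a colouring of the edges in which no two edges having a vertex in common receive the same colour. An immersion of a graph $H$ into a graph $G$ is a one-to-one map $\phi:V(H)\to V(G)$ together with a path $P_{uv}$ in $G$ joining $\phi(u)$ and $\phi(v)$ for each edge $uv\in E(H)$, such that the paths $P_{uv}$, $uv\in E(H)$, are pairwise edge-disjoint (the paths may pass through vertices of $\phi(V(H))$). *)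

theory Defs
  imports Complex_Main
begin

record 'a graph =
  verts :: "'a set"
  edges :: "'a set set"

definition simple_graph :: "'a graph \<Rightarrow> bool" where
  "simple_graph G \<longleftrightarrow>
     finite (verts G) \<and> (\<forall>e\<in>edges G. e \<subseteq> verts G \<and> card e = 2)"

definition degree :: "'a graph \<Rightarrow> 'a \<Rightarrow> nat" where
  "degree G v = card {e \<in> edges G. v \<in> e}"

text \<open>Only meaningful for finite graphs with at least one vertex.\<close>

definition min_degree :: "'a graph \<Rightarrow> nat" where
  "min_degree G = Min (degree G ` verts G)"

definition regular :: "nat \<Rightarrow> 'a graph \<Rightarrow> bool" where
  "regular D G \<longleftrightarrow> (\<forall>v\<in>verts G. degree G v = D)"

definition proper_edge_colouring :: "'a graph \<Rightarrow> ('a set \<Rightarrow> nat) \<Rightarrow> bool" where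
  "proper_edge_colouring G c \<longleftrightarrow>
     (\<forall>e\<in>edges G. \<forall>f\<in>edges G. e \<noteq> f \<and> e \<inter> f \<noteq> {} \<longrightarrow> c e \<noteq> c f)"

definition chromatic_index :: "'a graph \<Rightarrow> nat" where
  "chromatic_index G =
     (LEAST k. \<exists>c. proper_edge_colouring G c \<and> c ` edges G \<subseteq> {..<k})"

definition complement :: "'a graph \<Rightarrow> 'a graph" where
  "complement G =
     \<lparr>verts = verts G, edges = {e. e \<subseteq> verts G \<and> card e = 2 \<and> e \<notin> edges G}\<rparr>"

definition disjoint_union :: "'i set \<Rightarrow> ('i \<Rightarrow> 'a graph) \<Rightarrow> ('i \<times> 'a) graph" where
  "disjoint_union I H =
     \<lparr>verts = (SIGMA i:I. verts (H i)), edges = (\<Union>i\<in>I. (\<lambda>e. Pair i ` e) ` edges (H i))\<rparr>"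

definition complete_graph :: "nat \<Rightarrow> nat graph" where
  "complete_graph m = \<lparr>verts = {..<m}, edges = {e. e \<subseteq> {..<m} \<and> card e = 2}\<rparr>"

text \<open>A path is given by the list of its vertices, without repetition.\<close>

definition path_edges :: "'a list \<Rightarrow> 'a set set" where
  "path_edges p = {{p ! i, p ! Suc i} | i. Suc i < length p}"

definition is_path :: "'a graph \<Rightarrow> 'a list \<Rightarrow> bool" where
  "is_path G p \<longleftrightarrow> p \<noteq> [] \<and> distinct p \<and> set p \<subseteq> verts G \<and> path_edges p \<subseteq> edges G"

text \<open>
  The family of paths is indexed by the edges of \<open>H\<close>. For an edge \<open>e = {u, v}\<close> the condition
  \<open>{hd (P e), last (P e)} = \<phi> ` e\<close> says that \<open>P e\<close> has the ends \<open>\<phi> u\<close> and \<open>\<phi> v\<close>,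
  in either order.
\<close>

definition is_immersion ::
    "'b graph \<Rightarrow> 'a graph \<Rightarrow> ('b \<Rightarrow> 'a) \<Rightarrow> ('b set \<Rightarrow> 'a list) \<Rightarrow> bool" where
  "is_immersion H G \<phi> P \<longleftrightarrow>
     inj_on \<phi> (verts H) \<and> \<phi> ` verts H \<subseteq> verts G \<and>
     (\<forall>e\<in>edges H. is_path G (P e) \<and> {hd (P e), last (P e)} = \<phi> ` e) \<and>
     (\<forall>e\<in>edges H. \<forall>f\<in>edges H. e \<noteq> f \<longrightarrow> path_edges (P e) \<inter> path_edges (P f) = {})"

definition contains_immersion :: "'a graph \<Rightarrow> 'b graph \<Rightarrow> bool" where
  "contains_immersion G H \<longleftrightarrow> (\<exists>\<phi> P. is_immersion H G \<phi> P)"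

end

theory Submission
  imports Defs
begin

text \<open>
  Every vertex of \<open>G\<close> has degree \<open>n - 1 - D\<close>, which is exactly the degree of a vertex of the complete
  graph \<open>K\<close> on \<open>n - D\<close> vertices. In an immersion of \<open>K\<close> the edges of \<open>G\<close> at a branch vertex (the
  image of a vertex of \<open>K\<close>) are therefore all used up by the paths that end there, and no path runs
  through a branch vertex. So the interior vertices of all the paths lie in the set \<open>S\<close> of the
  remaining, at most \<open>D\<close>, vertices (\<open>immersion_no_transit\<close>, \<open>immersion_in_complement_linkage\<close>).

  Now look at an \<open>H i\<close> that contains no vertex of \<open>S\<close>. The ends of an edge of \<open>H i\<close> are branch vertices
  that are not adjacent in \<open>G\<close>, so they are joined by a path with at least one interior vertex. If
  each of these paths had just one interior vertex, then this vertex, an element of \<open>S\<close>, could serve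
  as the colour of the edge: two edges at \<open>x\<close> with the same colour \<open>s\<close> would both use the edge
  \<open>{x, s}\<close> of \<open>G\<close>. That would be a proper edge-colouring of \<open>H i\<close> with \<open>D\<close> colours
  (\<open>long_path_if_large_chromatic_index\<close>). Hence some path belonging to \<open>H i\<close> has two consecutive
  interior vertices, that is, uses an edge within \<open>S\<close>. Different \<open>H i\<close> use different edges,
  and \<open>S\<close> meets at most \<open>|S|\<close> of the \<open>H i\<close>, so \<open>t\<close> is at most \<open>|S| + (|S| choose 2)\<close>, which is
  at most \<open>D (D + 1) / 2\<close>.
\<close>

section \<open>Degrees in complements and disjoint unions\<close>

lemma simple_graph_complement: "simple_graph U \<Longrightarrow> simple_graph (complement U)"
  by (auto simp: simple_graph_def complement_def)

lemma finite_edges: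
  assumes "simple_graph U"
  shows "finite (edges U)"
  by (rule finite_subset[of _ "Pow (verts U)"]) (use assms in \<open>auto simp: simple_graph_def\<close>)

lemma card_pairs_at_vertex:
  assumes "finite V" "v \<in> V"
  shows "card {e. e \<subseteq> V \<and> card e = 2 \<and> v \<in> e} = card V - 1"
proof -
  have "{e. e \<subseteq> V \<and> card e = 2 \<and> v \<in> e} = (\<lambda>w. {v, w}) ` (V - {v})" (is "?L = ?R")
  proof
    show "?L \<subseteq> ?R"
    proof
      fix e assume "e \<in> ?L"
      then have e: "e \<subseteq> V" "card e = 2" "v \<in> e" by auto
      then obtain x y where "e = {x, y}" "x \<noteq> y" by (auto simp: card_2_iff)
      with e show "e \<in> ?R" by (auto simp: doubleton_eq_iff image_iff)
    qed
  qed (use assms in auto)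
  moreover have "inj_on (\<lambda>w. {v, w}) (V - {v})"
    by (auto simp: inj_on_def doubleton_eq_iff)
  ultimately show ?thesis
    using assms by (simp add: card_image)
qed

lemma degree_complete_graph: "k < m \<Longrightarrow> degree (complete_graph m) k = m - 1"
  using card_pairs_at_vertex[of "{..<m}" k]
  by (simp add: degree_def complete_graph_def conj_ac)

lemma simple_graph_complete_graph: "simple_graph (complete_graph m)"
  by (auto simp: simple_graph_def complete_graph_def)

lemma degree_complement:
  assumes "simple_graph U" "v \<in> verts U"
  shows "degree (complement U) v + degree U v = card (verts U) - 1"
proof -
  have "{e. e \<subseteq> verts U \<and> card e = 2 \<and> v \<in> e}
      = {e \<in> edges (complement U). v \<in> e} \<union> {e \<in> edges U. v \<in> e}"
    using assms(1) by (auto simp: simple_graph_def complement_def)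
  moreover have "card ({e \<in> edges (complement U). v \<in> e} \<union> {e \<in> edges U. v \<in> e})
      = degree (complement U) v + degree U v"
    unfolding degree_def
  proof (rule card_Un_disjoint)
    show "finite {e \<in> edges (complement U). v \<in> e}" "finite {e \<in> edges U. v \<in> e}"
      using finite_edges[OF assms(1)] finite_edges[OF simple_graph_complement[OF assms(1)]]
      by simp_all
  qed (auto simp: complement_def)
  ultimately show ?thesis
    using card_pairs_at_vertex[of "verts U" v] assms by (simp add: simple_graph_def)
qed

lemma simple_graph_disjoint_union:
  assumes "finite I" "\<And>i. i \<in> I \<Longrightarrow> simple_graph (H i)"
  shows "simple_graph (disjoint_union I H)"
proof -
  have "card (Pair i ` e) = card e" for i :: 'a and e :: "'b set"
    by (rule card_image) (auto simp: inj_on_def)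
  then show ?thesis
    using assms by (fastforce simp: simple_graph_def disjoint_union_def)
qed

lemma degree_disjoint_union:
  assumes "i \<in> I"
  shows "degree (disjoint_union I H) (i, v) = degree (H i) v"
proof -
  have "{e \<in> edges (disjoint_union I H). (i, v) \<in> e} = image (Pair i) ` {e \<in> edges (H i). v \<in> e}"
    using assms by (auto simp: disjoint_union_def)
  moreover have "inj (image (Pair i) :: 'b set \<Rightarrow> _)"
    by (auto intro!: inj_onI simp: inj_image_eq_iff)
  ultimately show ?thesis
    by (simp add: degree_def card_image inj_on_subset)
qed

section \<open>Branch vertices without spare edges\<close>

lemma path_edge_at_vertex:
  assumes "v \<in> set p" "length p \<ge> 2"
  shows "\<exists>a\<in>path_edges p. v \<in> a"
proof -
  obtain i where i: "i < length p" "p ! i = v"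
    using assms(1) by (auto simp: in_set_conv_nth)
  show ?thesis
  proof (cases "Suc i < length p")
    case True
    with i show ?thesis by (auto simp: path_edges_def)
  next
    case False
    with i assms(2) have "Suc (i - 1) < length p" "Suc (i - 1) = i" by auto
    with i have "{p ! (i - 1), v} \<in> path_edges p" by (force simp: path_edges_def)
    then show ?thesis by blast
  qed
qed

lemma length_ge_2_if_ends:
  assumes "p \<noteq> []" "{hd p, last p} = e" "card e = 2"
  shows "length p \<ge> 2"
proof (rule ccontr)
  assume "\<not> length p \<ge> 2"
  then have "length p = 1" using assms(1) by (simp add: not_le less_2_cases_iff)
  then have "hd p = last p" by (auto simp: length_Suc_conv)
  with assms show False by auto
qed

text \<open>
  Choosing for each edge of \<open>K\<close> at \<open>k\<close> an edge at \<open>\<phi> k\<close> on its path is an injection, by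
  edge-disjointness; the degree condition makes it onto. An edge at \<open>\<phi> k\<close> on the path of \<open>f\<close> is
  therefore also on the path of an edge of \<open>K\<close> at \<open>k\<close>, and this edge must be \<open>f\<close>.
\<close>

lemma immersion_no_transit:
  assumes imm: "is_immersion K G \<phi> P"
    and K: "simple_graph K" and G: "simple_graph G"
    and deg: "degree G (\<phi> k) \<le> degree K k"
    and f: "f \<in> edges K" "\<phi> k \<in> set (P f)"
  shows "k \<in> f"
proof -
  have inj: "inj_on \<phi> (verts K)"
    and path: "\<And>e. e \<in> edges K \<Longrightarrow> is_path G (P e)"
    and ends: "\<And>e. e \<in> edges K \<Longrightarrow> {hd (P e), last (P e)} = \<phi> ` e"
    and disj: "\<And>e g. \<lbrakk>e \<in> edges K; g \<in> edges K; e \<noteq> g\<rbrakk> \<Longrightarrow> path_edges (P e) \<inter> path_edges (P g) = {}"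
    using imm by (auto simp: is_immersion_def)
  have len: "length (P e) \<ge> 2" if e: "e \<in> edges K" for e
  proof (rule length_ge_2_if_ends[OF _ ends[OF e]])
    show "P e \<noteq> []" using path[OF e] by (simp add: is_path_def)
    show "card (\<phi> ` e) = 2"
      using K e inj by (metis card_image inj_on_subset simple_graph_def)
  qed
  define A where "A = {e \<in> edges K. k \<in> e}"
  have "\<exists>a\<in>path_edges (P e). \<phi> k \<in> a" if e: "e \<in> A" for e
  proof (rule path_edge_at_vertex)
    have eK: "e \<in> edges K" using e by (simp add: A_def)
    have "P e \<noteq> []" using path[OF eK] by (simp add: is_path_def)
    moreover have "\<phi> k \<in> {hd (P e), last (P e)}"
      using e ends[OF eK] by (auto simp: A_def)
    ultimately show "\<phi> k \<in> set (P e)" by auto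
    show "length (P e) \<ge> 2" using len[OF eK] .
  qed
  then obtain E where E: "\<And>e. e \<in> A \<Longrightarrow> E e \<in> path_edges (P e) \<and> \<phi> k \<in> E e"
    by metis
  have pe: "path_edges (P e) \<subseteq> edges G" if "e \<in> edges K" for e
    using path[OF that] by (simp add: is_path_def)
  have injE: "inj_on E A"
    using E disj by (fastforce simp: inj_on_def A_def)
  define B where "B = {a \<in> edges G. \<phi> k \<in> a}"
  have finB: "finite B" using finite_edges[OF G] by (simp add: B_def)
  have "E ` A \<subseteq> B"
    using E pe by (force simp: A_def B_def)
  moreover have "card B \<le> card (E ` A)"
    using deg by (simp add: card_image[OF injE]) (simp add: A_def B_def degree_def)
  ultimately have onto: "E ` A = B"
    using finB by (meson card_seteq)
  obtain a where a: "a \<in> path_edges (P f)" "\<phi> k \<in> a"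
    using path_edge_at_vertex[OF f(2) len[OF f(1)]] by blast
  then have "a \<in> E ` A" using pe[OF f(1)] onto by (auto simp: B_def)
  then obtain e where e: "e \<in> A" "a = E e" by blast
  then have "a \<in> path_edges (P e) \<inter> path_edges (P f)" using E a by auto
  then have "e = f" using disj[of e f] e f(1) by (auto simp: A_def)
  then show "k \<in> f" using e by (simp add: A_def)
qed

text \<open>
  The degree condition of \<open>immersion_no_transit\<close> holds at every branch vertex here. The paths are
  reindexed by the edges of \<open>U\<close> between branch vertices, since these edges are what is to be coloured.
\<close>

lemma immersion_in_complement_linkage:
  assumes U: "simple_graph U" and reg: "regular D U"
    and imm: "contains_immersion (complement U) (complete_graph (card (verts U) - D))"
  obtains S Q where "S \<subseteq> verts U" "card S \<le> D"
    "\<And>a. \<lbrakk>a \<in> edges U; a \<inter> S = {}\<rbrakk> \<Longrightarrow> is_path (complement U) (Q a)"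
    "\<And>a. \<lbrakk>a \<in> edges U; a \<inter> S = {}\<rbrakk> \<Longrightarrow> {hd (Q a), last (Q a)} = a"
    "\<And>a. \<lbrakk>a \<in> edges U; a \<inter> S = {}\<rbrakk> \<Longrightarrow> set (Q a) - a \<subseteq> S"
    "\<And>a b. \<lbrakk>a \<in> edges U; a \<inter> S = {}; b \<in> edges U; b \<inter> S = {}; a \<noteq> b\<rbrakk>
      \<Longrightarrow> path_edges (Q a) \<inter> path_edges (Q b) = {}"
proof -
  define m where "m = card (verts U) - D"
  define K where "K = complete_graph m"
  obtain \<phi> P where imm': "is_immersion K (complement U) \<phi> P"
    using imm by (auto simp: contains_immersion_def K_def m_def)
  have inj: "inj_on \<phi> {..<m}" and B: "\<phi> ` {..<m} \<subseteq> verts U"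
    and path: "\<And>e. e \<in> edges K \<Longrightarrow> is_path (complement U) (P e)"
    and ends: "\<And>e. e \<in> edges K \<Longrightarrow> {hd (P e), last (P e)} = \<phi> ` e"
    and disj: "\<And>e g. \<lbrakk>e \<in> edges K; g \<in> edges K; e \<noteq> g\<rbrakk> \<Longrightarrow> path_edges (P e) \<inter> path_edges (P g) = {}"
    using imm' by (auto simp: is_immersion_def K_def complete_graph_def complement_def)
  define S where "S = verts U - \<phi> ` {..<m}"
  define pre where "pre a = {k. k < m \<and> \<phi> k \<in> a}" for a
  have finV: "finite (verts U)" using U by (simp add: simple_graph_def)
  have "card S = card (verts U) - m"
    unfolding S_def using B finV by (simp add: card_Diff_subset finite_subset card_image[OF inj])
  then have cardS: "card S \<le> D" by (simp add: m_def)
  have a_sub: "a \<subseteq> \<phi> ` {..<m}" if "a \<in> edges U" "a \<inter> S = {}" for a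
    using that U by (auto simp: S_def simple_graph_def)
  have img: "\<phi> ` pre a = a" if "a \<in> edges U" "a \<inter> S = {}" for a
    using a_sub[OF that] by (auto simp: pre_def)
  have preK: "pre a \<in> edges K" if a: "a \<in> edges U" "a \<inter> S = {}" for a
  proof -
    have "inj_on \<phi> (pre a)" using inj by (auto simp: pre_def inj_on_def)
    then have "card (pre a) = card a" using img[OF a] card_image by metis
    also have "\<dots> = 2" using U a by (simp add: simple_graph_def)
    finally show ?thesis by (auto simp: K_def complete_graph_def pre_def)
  qed
  have deg: "degree (complement U) (\<phi> k) \<le> degree K k" if k: "k < m" for k
  proof -
    have v: "\<phi> k \<in> verts U" using B k by auto
    have "degree (complement U) (\<phi> k) + D = card (verts U) - 1"
      using degree_complement[OF U v] reg v by (simp add: regular_def)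
    then show ?thesis using degree_complete_graph[OF k] by (simp add: K_def m_def)
  qed
  have inner: "set (P (pre a)) - a \<subseteq> S" if a: "a \<in> edges U" "a \<inter> S = {}" for a
  proof
    fix v assume v: "v \<in> set (P (pre a)) - a"
    have "v \<in> verts U"
      using path[OF preK[OF a]] v by (auto simp: is_path_def complement_def)
    moreover have "v \<noteq> \<phi> k" if k: "k < m" for k
    proof
      assume vk: "v = \<phi> k"
      have "k \<in> pre a"
        using immersion_no_transit[OF imm' _ simple_graph_complement[OF U] deg[OF k] preK[OF a]] v vk
        by (simp add: K_def simple_graph_complete_graph)
      then show False using v vk by (simp add: pre_def)
    qed
    ultimately show "v \<in> S" by (auto simp: S_def)
  qed
  show thesis
  proof (rule that[of S "\<lambda>a. P (pre a)"])
    show "S \<subseteq> verts U" by (auto simp: S_def)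
    show "path_edges (P (pre a)) \<inter> path_edges (P (pre b)) = {}"
      if "a \<in> edges U" "a \<inter> S = {}" "b \<in> edges U" "b \<inter> S = {}" "a \<noteq> b" for a b
      using disj[OF preK preK] img that by metis
  qed (use cardS path preK ends img inner in auto)
qed

section \<open>Reading off an edge-colouring\<close>

lemma chromatic_index_le_card:
  assumes "finite S" "\<And>e. e \<in> edges G \<Longrightarrow> c e \<in> S"
    and proper: "\<And>e f. \<lbrakk>e \<in> edges G; f \<in> edges G; e \<noteq> f; e \<inter> f \<noteq> {}\<rbrakk> \<Longrightarrow> c e \<noteq> c f"
  shows "chromatic_index G \<le> card S"
proof -
  obtain h where h: "bij_betw h S {0..<card S}"
    using ex_bij_betw_finite_nat[OF assms(1)] by blast
  have "proper_edge_colouring G (h \<circ> c)"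
    unfolding proper_edge_colouring_def comp_def using assms(2) proper h
    by (metis bij_betw_imp_inj_on inj_on_eq_iff)
  moreover have "(h \<circ> c) ` edges G \<subseteq> {..<card S}"
    using assms(2) h by (auto simp: bij_betw_def)
  ultimately show ?thesis
    unfolding chromatic_index_def by (blast intro: Least_le)
qed

text \<open>
  The graph \<open>H\<close> sits inside the complement of \<open>G\<close> by means of \<open>\<iota>\<close>, so each path below has at least
  three vertices. When all of them have exactly three, the middle vertices form a proper colouring.
\<close>

lemma long_path_if_large_chromatic_index:
  fixes \<iota> :: "'a \<Rightarrow> 'b"
  assumes "finite S" and chi: "chromatic_index H > card S"
    and H: "simple_graph H" and "inj \<iota>"
    and nonadj: "\<And>e. e \<in> edges H \<Longrightarrow> \<iota> ` e \<notin> edges G"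
    and path: "\<And>e. e \<in> edges H \<Longrightarrow> is_path G (Q e)"
    and ends: "\<And>e. e \<in> edges H \<Longrightarrow> {hd (Q e), last (Q e)} = \<iota> ` e"
    and inner: "\<And>e. e \<in> edges H \<Longrightarrow> set (Q e) - \<iota> ` e \<subseteq> S"
    and disj: "\<And>e f. \<lbrakk>e \<in> edges H; f \<in> edges H; e \<noteq> f\<rbrakk> \<Longrightarrow> path_edges (Q e) \<inter> path_edges (Q f) = {}"
  shows "\<exists>e\<in>edges H. \<exists>a\<in>path_edges (Q e). a \<subseteq> S \<and> card a = 2"
proof (rule ccontr)
  assume no: "\<not> ?thesis"
  have three: "length (Q e) = 3" if e: "e \<in> edges H" for e
  proof -
    let ?p = "Q e"
    have dist: "distinct ?p" and pe: "path_edges ?p \<subseteq> edges G" and ne: "?p \<noteq> []"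
      using path[OF e] by (auto simp: is_path_def)
    have "card (\<iota> ` e) = 2"
      using H e \<open>inj \<iota>\<close> by (simp add: card_image inj_on_subset simple_graph_def)
    then have "length ?p \<ge> 2" using length_ge_2_if_ends[OF ne ends[OF e]] by simp
    moreover have "length ?p \<noteq> 2"
    proof
      assume l: "length ?p = 2"
      then have "{?p ! 0, ?p ! Suc 0} \<in> path_edges ?p" by (force simp: path_edges_def)
      moreover have "{?p ! 0, ?p ! Suc 0} = \<iota> ` e"
        using l ne ends[OF e] by (simp add: hd_conv_nth last_conv_nth)
      ultimately show False using pe nonadj[OF e] by auto
    qed
    moreover have "\<not> length ?p \<ge> 4"
    proof
      assume l: "length ?p \<ge> 4"
      have out: "?p ! j \<in> S" if j: "0 < j" "Suc j < length ?p" for j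
      proof -
        have "?p ! j \<noteq> ?p ! 0" "?p ! j \<noteq> ?p ! (length ?p - 1)"
          using dist j ne nth_eq_iff_index_eq[OF dist, of j 0]
          nth_eq_iff_index_eq[OF dist, of j "length ?p - 1"] by force+
        then have "?p ! j \<notin> \<iota> ` e"
          using ne ends[OF e, symmetric] by (simp add: hd_conv_nth last_conv_nth)
        then show ?thesis using inner[OF e] j by (auto simp: subset_iff)
      qed
      have "{?p ! 1, ?p ! Suc 1} \<in> path_edges ?p" unfolding path_edges_def using l by force
      moreover have "{?p ! 1, ?p ! Suc 1} \<subseteq> S" using out[of 1] out[of 2] l
        by (simp add: numeral_2_eq_2)
      moreover have "?p ! 1 \<noteq> ?p ! Suc 1" using dist l by (subst nth_eq_iff_index_eq) auto
      ultimately show False using no e by (auto simp: card_2_iff)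
    qed
    ultimately show ?thesis by linarith
  qed
  have shape: "Q e ! 1 \<in> S \<and> (\<forall>x\<in>e. {\<iota> x, Q e ! 1} \<in> path_edges (Q e))" if e: "e \<in> edges H" for e
  proof -
    obtain u s w where q: "Q e = [u, s, w]"
      using three[OF e] by (auto simp: length_Suc_conv numeral_3_eq_3)
    have uw: "{u, w} = \<iota> ` e" using ends[OF e] q by simp
    have "s \<notin> \<iota> ` e" using path[OF e] q uw[symmetric] by (auto simp: is_path_def)
    then have "s \<in> S" using inner[OF e] q by auto
    moreover have "{u, s} \<in> path_edges (Q e)"
      unfolding path_edges_def q by (rule CollectI, rule exI[of _ 0]) simp
    moreover have "{w, s} \<in> path_edges (Q e)"
      unfolding path_edges_def q by (rule CollectI, rule exI[of _ 1]) auto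
    ultimately show ?thesis using uw q by auto
  qed
  have "chromatic_index H \<le> card S"
  proof (rule chromatic_index_le_card[where c = "\<lambda>e. Q e ! 1"])
    fix e f assume ef: "e \<in> edges H" "f \<in> edges H" "e \<noteq> f" "e \<inter> f \<noteq> {}"
    then obtain x where "x \<in> e" "x \<in> f" by blast
    then show "Q e ! 1 \<noteq> Q f ! 1"
      using shape[OF ef(1)] shape[OF ef(2)] disj[OF ef(1-3)] by (metis disjoint_iff)
  qed (use \<open>finite S\<close> shape in auto)
  with chi show False by simp
qed

section \<open>Counting the edges within the remaining vertices\<close>

text \<open>
  The vertices of \<open>S\<close> meet at most \<open>|S|\<close> summands; each other summand claims a pair within \<open>S\<close> for
  itself.
\<close>

lemma no_immersion_in_complement_of_disjoint_union:
  fixes H :: "'i \<Rightarrow> 'a graph"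
  assumes "finite I"
    and H: "\<And>i. i \<in> I \<Longrightarrow> simple_graph (H i)"
    and reg: "\<And>i. i \<in> I \<Longrightarrow> regular D (H i)"
    and chi: "\<And>i. i \<in> I \<Longrightarrow> chromatic_index (H i) > D"
    and big: "D * (D + 1) < 2 * card I"
  defines "U \<equiv> disjoint_union I H"
  shows "\<not> contains_immersion (complement U) (complete_graph (card (verts U) - D))"
proof
  assume imm: "contains_immersion (complement U) (complete_graph (card (verts U) - D))"
  have U: "simple_graph U"
    unfolding U_def using \<open>finite I\<close> H by (rule simple_graph_disjoint_union)
  have regU: "regular D U"
    using reg degree_disjoint_union[of _ I H]
    by (auto simp: U_def regular_def disjoint_union_def)
  obtain S Q where S: "S \<subseteq> verts U" "card S \<le> D"
    and path: "\<And>a. \<lbrakk>a \<in> edges U; a \<inter> S = {}\<rbrakk> \<Longrightarrow> is_path (complement U) (Q a)"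
    and ends: "\<And>a. \<lbrakk>a \<in> edges U; a \<inter> S = {}\<rbrakk> \<Longrightarrow> {hd (Q a), last (Q a)} = a"
    and inner: "\<And>a. \<lbrakk>a \<in> edges U; a \<inter> S = {}\<rbrakk> \<Longrightarrow> set (Q a) - a \<subseteq> S"
    and disj: "\<And>a b. \<lbrakk>a \<in> edges U; a \<inter> S = {}; b \<in> edges U; b \<inter> S = {}; a \<noteq> b\<rbrakk>
      \<Longrightarrow> path_edges (Q a) \<inter> path_edges (Q b) = {}"
    using immersion_in_complement_linkage[OF U regU imm] by blast
  have finS: "finite S" using S(1) U finite_subset by (auto simp: simple_graph_def)
  define J where "J = I - fst ` S"
  have edge: "Pair i ` e \<in> edges U" "Pair i ` e \<inter> S = {}" if "i \<in> J" "e \<in> edges (H i)" for i e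
    using that by (force simp: J_def U_def disjoint_union_def)+
  have injP: "inj (Pair i :: 'a \<Rightarrow> 'i \<times> 'a)" for i by (auto simp: inj_on_def)
  have "\<exists>e\<in>edges (H i). \<exists>a\<in>path_edges (Q (Pair i ` e)). a \<subseteq> S \<and> card a = 2" if i: "i \<in> J" for i
  proof (rule long_path_if_large_chromatic_index[where \<iota> = "Pair i" and G = "complement U"])
    show "card S < chromatic_index (H i)" "simple_graph (H i)"
      using chi[of i] H[of i] S(2) i by (auto simp: J_def)
    show "Pair i ` e \<notin> edges (complement U)" if "e \<in> edges (H i)" for e
      using edge[OF i that] by (simp add: complement_def)
    show "path_edges (Q (Pair i ` e)) \<inter> path_edges (Q (Pair i ` f)) = {}"
      if "e \<in> edges (H i)" "f \<in> edges (H i)" "e \<noteq> f" for e f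
      using that edge[OF i] injP[of i] by (intro disj) (auto simp: inj_image_eq_iff)
  qed (use finS injP path ends inner edge i in auto)
  then obtain e a where e: "\<And>i. i \<in> J \<Longrightarrow> e i \<in> edges (H i)"
    and a: "\<And>i. i \<in> J \<Longrightarrow> a i \<in> path_edges (Q (Pair i ` e i)) \<and> a i \<subseteq> S \<and> card (a i) = 2"
    by metis
  have "inj_on a J"
  proof (rule inj_onI, rule ccontr)
    fix i j assume ij: "i \<in> J" "j \<in> J" "a i = a j" "i \<noteq> j"
    have "e i \<noteq> {}" using H[of i] e[of i] ij(1) by (force simp: simple_graph_def J_def)
    then have "Pair i ` e i \<noteq> Pair j ` e j" using \<open>i \<noteq> j\<close> by auto
    then show False
      using disj[OF edge[OF ij(1) e[OF ij(1)]] edge[OF ij(2) e[OF ij(2)]]] a[OF ij(1)] a[OF ij(2)] ij(3)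
      by auto
  qed
  moreover have "a ` J \<subseteq> {b. b \<subseteq> S \<and> card b = 2}" using a by auto
  ultimately have "card J \<le> card {b. b \<subseteq> S \<and> card b = 2}"
    using finS by (intro card_inj_on_le) auto
  then have J_le: "card J \<le> card S choose 2" using n_subsets[OF finS] by simp
  have "card I \<le> card J + card (fst ` S)"
    using card_Un_le[of J "fst ` S"] card_mono[of "J \<union> fst ` S" I] \<open>finite I\<close> finS
    by (auto simp: J_def)
  also have "\<dots> \<le> (card S choose 2) + card S"
    using J_le card_image_le[OF finS, of fst] by linarith
  finally have "2 * card I \<le> 2 * (card S choose 2) + 2 * card S" by simp
  also have "\<dots> = card S * (card S + 1)"
    by (cases "card S") (simp_all add: choose_two)
  also have "\<dots> \<le> D * (D + 1)" using S(2) by (intro mult_le_mono) auto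
  finally show False using big by simp
qed

theorem theorem5p2:
  fixes H :: "nat \<Rightarrow> 'a graph" and G :: "(nat \<times> 'a) graph" and D t n :: nat
  assumes "\<And>i. i \<in> {1..t} \<Longrightarrow> simple_graph (H i)"
    and "\<And>i. i \<in> {1..t} \<Longrightarrow> regular D (H i)"
    and "\<And>i. i \<in> {1..t} \<Longrightarrow> chromatic_index (H i) = D + 1"
    and "real t > 1 / 2 * real D * (real D + 1)"
    and "G = complement (disjoint_union {1..t} H)"
    and "n = card (verts G)"
  shows "int (min_degree G) = int n - 1 - int D \<and>
    \<not> contains_immersion G (complete_graph (n - D))"
proof
  define U where "U = disjoint_union {1..t} H"
  have G: "G = complement U" and n: "n = card (verts U)"
    using assms(5,6) by (simp_all add: U_def complement_def)
  have U: "simple_graph U"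
    unfolding U_def using assms(1) by (intro simple_graph_disjoint_union) auto
  have "0 \<le> 1 / 2 * real D * (real D + 1)" by simp
  then have "real t > 0" using assms(4) by linarith
  then have t: "1 \<in> {1..t}" by simp

  \<comment> \<open>A graph without vertices has chromatic index 0, so \<open>H 1\<close> has a vertex and the minimum is
      taken over a nonempty set.\<close>
  have "verts (H 1) \<noteq> {}"
  proof
    assume "verts (H 1) = {}"
    then have "edges (H 1) = {}" using assms(1)[OF t] by (force simp: simple_graph_def)
    then have "chromatic_index (H 1) \<le> card ({} :: nat set)"
      by (intro chromatic_index_le_card) auto
    then show False using assms(3)[OF t] by simp
  qed
  then have ne: "verts U \<noteq> {}" using t by (force simp: U_def disjoint_union_def)
  have finV: "finite (verts U)" using U by (simp add: simple_graph_def)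
  have "degree G v = n - 1 - D \<and> D \<le> n - 1" if v: "v \<in> verts U" for v
  proof -
    obtain i x where ix: "v = (i, x)" "i \<in> {1..t}" "x \<in> verts (H i)"
      using v by (auto simp: U_def disjoint_union_def)
    then have "degree U v = D"
      using assms(2)[OF ix(2)] degree_disjoint_union[OF ix(2), of H x]
      by (simp add: U_def regular_def)
    then show ?thesis using degree_complement[OF U v] by (simp add: G n)
  qed
  then have img: "degree G ` verts G = {n - 1 - D}" and le: "D \<le> n - 1"
    using ne by (auto simp: G complement_def image_iff)
  have "n \<ge> 1" using ne finV n by (simp add: Suc_le_eq card_gt_0_iff)
  with img le show "int (min_degree G) = int n - 1 - int D"
    by (simp add: min_degree_def)

  have "real (D * (D + 1)) < real (2 * card {1..t})" using assms(4) by (simp add: algebra_simps)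
  then have "D * (D + 1) < 2 * card {1..t}" by (simp only: of_nat_less_iff)
  then show "\<not> contains_immersion G (complete_graph (n - D))"
    unfolding G n U_def using assms(1-3)
    by (intro no_immersion_in_complement_of_disjoint_union) auto
qed

end
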